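(* For every knot type $K$ and every geometric size functional $D$, $$\operatorname{Rop}(K)\ge\rho_D(K)\operatorname{CRad}_D(K).$$
   Context: Curves are in $\mathbb R^3$. For a knot type $K$, $\mathcal H(K)$ is the set of $C^{1,1}$ embedded closed curves representing $K$ and having positive thickness (admissible representatives). $\operatorname{Len}$ is length, and the thickness $\operatorname{Thi}(\gamma)$ is the tube radius: the supremum of $r>0$ such that the open disks of radius $r$ centred at the points of $\gamma$ in the planes normal to $\gamma$ are pairwise disjoint. A geometric size functional $D$ assigns to each admissible embedded closed curve a real number $D(\gamma)$ with $D(g\gamma)=D(\gamma)$ for every Euclidean isometry $g$ of $\mathbb R^3$, $D(a\gamma)=aD(\gamma)$ for every $a>0$, and $D(\gamma)>0$. For $\gamma\in\mathcal H(K)$: $\operatorname{Rop}(\gamma)=\operatorname{Len}(\gamma)/\operatorname{Thi}(\gamma)$, $\rho_D(\gamma)=\operatorname{Len}(\gamma)/D(\gamma)$, $\operatorname{CRad}_D(\gamma)=D(\gamma)/\operatorname{Thi}(\gamma)$. The invariants $\operatorname{Rop}(K)$, $\rho_D(K)$, $\operatorname{CRad}_D(K)$ are the infima of these quantities over $\gamma\in\mathcal H(K)$. *)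

theory Defs
  imports "HOL-Analysis.Analysis"
begin

text \<open>A closed curve is represented by its point set in \<open>\<real>\<^sup>3\<close>; parametrizations enter only
  through existential quantifiers or through quantities that do not depend on their choice.\<close>

definition ambient_isotopic :: "(real^3) set \<Rightarrow> (real^3) set \<Rightarrow> bool" where
  "ambient_isotopic C C' \<longleftrightarrow>
     (\<exists>H :: real \<times> (real^3) \<Rightarrow> real^3.
        continuous_on ({0..1} \<times> UNIV) H \<and>
        (\<forall>t\<in>{0..1}. \<exists>g. homeomorphism UNIV UNIV (\<lambda>x. H (t, x)) g) \<and>
        (\<forall>x. H (0, x) = x) \<and>
        (\<lambda>x. H (1, x)) ` C = C')"

definition knots :: "(real^3) set set" where
  "knots = {C. C homeomorphic sphere (0 :: complex) 1}"

definition knot_types :: "(real^3) set set set" where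
  "knot_types = knots // {(C, C'). C \<in> knots \<and> C' \<in> knots \<and> ambient_isotopic C C'}"

text \<open>Embedded closed curves of class \<open>C\<^sup>1\<^sup>,\<^sup>1\<close>: a regular (immersed), 1-periodic
  parametrization with Lipschitz derivative, injective on a period.\<close>

definition C11_parametrization :: "(real \<Rightarrow> real^3) \<Rightarrow> (real^3) set \<Rightarrow> bool" where
  "C11_parametrization \<gamma> C \<longleftrightarrow>
     (\<forall>t. \<gamma> (t + 1) = \<gamma> t) \<and>
     (\<forall>t. \<gamma> differentiable at t) \<and>
     (\<forall>t. vector_derivative \<gamma> (at t) \<noteq> 0) \<and>
     (\<exists>L. L-lipschitz_on UNIV (\<lambda>t. vector_derivative \<gamma> (at t))) \<and>
     inj_on \<gamma> {0..<1} \<and>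
     range \<gamma> = C"

definition C11_closed_curve :: "(real^3) set \<Rightarrow> bool" where
  "C11_closed_curve C \<longleftrightarrow> (\<exists>\<gamma>. C11_parametrization \<gamma> C)"

text \<open>The integral is the same for every \<open>C\<^sup>1\<^sup>,\<^sup>1\<close> parametrization of a given curve, so the
  choice operator is harmless.\<close>

definition Len :: "(real^3) set \<Rightarrow> real" where
  "Len C = (let \<gamma> = (SOME \<gamma>. C11_parametrization \<gamma> C)
            in integral {0..1} (\<lambda>t. norm (vector_derivative \<gamma> (at t))))"

definition tangent_vectors :: "(real^3) set \<Rightarrow> real^3 \<Rightarrow> (real^3) set" where
  "tangent_vectors C p =
     {vector_derivative \<gamma> (at t) | \<gamma> t. C11_parametrization \<gamma> C \<and> \<gamma> t = p}"

definition normal_disk :: "(real^3) set \<Rightarrow> real \<Rightarrow> real^3 \<Rightarrow> (real^3) set" where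
  "normal_disk C r p = {x \<in> ball p r. \<forall>v \<in> tangent_vectors C p. orthogonal (x - p) v}"

text \<open>Inserting 0 makes the supremum equal to 0 when no radius qualifies. The set is bounded above
  for every \<open>C\<^sup>1\<^sup>,\<^sup>1\<close> closed curve, since two non-parallel normal planes of the curve meet.\<close>

definition Thi :: "(real^3) set \<Rightarrow> real" where
  "Thi C = Sup (insert 0 {r. 0 < r \<and> disjoint_family_on (normal_disk C r) C})"

definition admissible :: "(real^3) set \<Rightarrow> bool" where
  "admissible C \<longleftrightarrow> C11_closed_curve C \<and> 0 < Thi C"

definition admissible_reps :: "(real^3) set set \<Rightarrow> (real^3) set set" where
  "admissible_reps K = {C \<in> K. admissible C}"

text \<open>Only the values of \<open>D\<close> on admissible curves are constrained and used. A distance-preserving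
  self-map of \<open>\<real>\<^sup>3\<close> is automatically surjective.\<close>

definition geometric_size_functional :: "((real^3) set \<Rightarrow> real) \<Rightarrow> bool" where
  "geometric_size_functional D \<longleftrightarrow>
     (\<forall>C. admissible C \<longrightarrow>
        (\<forall>g :: real^3 \<Rightarrow> real^3. (\<forall>x y. dist (g x) (g y) = dist x y) \<longrightarrow> D (g ` C) = D C) \<and>
        (\<forall>a>0. D ((\<lambda>x. a *\<^sub>R x) ` C) = a * D C) \<and>
        0 < D C)"

definition Rop :: "(real^3) set \<Rightarrow> real" where
  "Rop C = Len C / Thi C"

definition rho :: "((real^3) set \<Rightarrow> real) \<Rightarrow> (real^3) set \<Rightarrow> real" where
  "rho D C = Len C / D C"

definition CRad :: "((real^3) set \<Rightarrow> real) \<Rightarrow> (real^3) set \<Rightarrow> real" where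
  "CRad D C = D C / Thi C"

text \<open>The infima are taken in the extended reals, so that a (wild) knot type without admissible
  representatives gets the value \<open>\<infinity>\<close>; otherwise they are infima of nonempty sets of
  nonnegative reals, hence real.\<close>

definition Rop_type :: "(real^3) set set \<Rightarrow> ereal" where
  "Rop_type K = (INF C\<in>admissible_reps K. ereal (Rop C))"

definition rho_type :: "((real^3) set \<Rightarrow> real) \<Rightarrow> (real^3) set set \<Rightarrow> ereal" where
  "rho_type D K = (INF C\<in>admissible_reps K. ereal (rho D C))"

definition CRad_type :: "((real^3) set \<Rightarrow> real) \<Rightarrow> (real^3) set set \<Rightarrow> ereal" where
  "CRad_type D K = (INF C\<in>admissible_reps K. ereal (CRad D C))"

end

theory Submission
  imports Defs
begin

text \<open>For a single admissible curve the size \<open>D C\<close> cancels, so ropelength is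
  exactly the product of \<open>rho\<close> and \<open>CRad\<close> (\<open>rho_mult_CRad\<close>).
  Each factor is at least its infimum over the knot type, and both are nonnegative, so the product
  of the infima is a lower bound for every ropelength.\<close>

text \<open>The integrand is a norm, and a non-integrable function has integral 0 by convention;
  hence nothing about the chosen parametrization matters.\<close>

lemma Len_nonneg: "0 \<le> Len C"
  unfolding Len_def Let_def
  by (metis (no_types, lifting) integral_nonneg norm_ge_zero not_integrable_integral order_refl)

lemma rho_nonneg:
  assumes "geometric_size_functional D" "admissible C"
  shows "0 \<le> rho D C"
  using assms Len_nonneg[of C] by (simp add: geometric_size_functional_def rho_def order_less_imp_le)

lemma CRad_nonneg:
  assumes "geometric_size_functional D" "admissible C"
  shows "0 \<le> CRad D C"
  using assms
  by (simp add: geometric_size_functional_def CRad_def admissible_def order_less_imp_le)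

lemma rho_mult_CRad:
  assumes "geometric_size_functional D" "admissible C"
  shows "rho D C * CRad D C = Rop C"
proof -
  have "D C \<noteq> 0"
    using assms unfolding geometric_size_functional_def by force
  then show ?thesis
    by (simp add: rho_def CRad_def Rop_def)
qed

theorem lemma3p6:
  fixes K :: "(real^3) set set" and D :: "(real^3) set \<Rightarrow> real"
  assumes "K \<in> knot_types"
    and "geometric_size_functional D"
  shows "Rop_type K \<ge> rho_type D K * CRad_type D K"
  \<comment> \<open>If there are no admissible representatives, the infimum is \<infinity> and the
    bound is vacuous.\<close>
  unfolding Rop_type_def
proof (rule INF_greatest)
  fix C assume C: "C \<in> admissible_reps K"
  then have adm: "admissible C"
    by (simp add: admissible_reps_def)
  have "0 \<le> CRad_type D K"
    unfolding CRad_type_def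
    by (rule INF_greatest) (simp add: admissible_reps_def CRad_nonneg[OF assms(2)])
  moreover have "rho_type D K \<le> ereal (rho D C)"
    unfolding rho_type_def using C by (rule INF_lower)
  moreover have "CRad_type D K \<le> ereal (CRad D C)"
    unfolding CRad_type_def using C by (rule INF_lower)
  \<comment> \<open>Monotonicity is applied to one factor at a time, so the signs used are those of
    \<open>rho D C\<close> and \<open>CRad_type D K\<close>.\<close>
  ultimately have "rho_type D K * CRad_type D K \<le> ereal (rho D C) * ereal (CRad D C)"
    using rho_nonneg[OF assms(2) adm] by (intro ereal_mult_mono) simp_all
  also have "\<dots> = ereal (Rop C)"
    by (simp add: rho_mult_CRad[OF assms(2) adm])
  finally show "rho_type D K * CRad_type D K \<le> ereal (Rop C)" .
qed

end
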